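(* Let $X=\{x_1,\dots,x_n\}$ be a finite set and let $\omega=(\omega_1,\dots,\omega_n)$ satisfy $\omega_j\in(0,1]$ and $\sum_{j=1}^n\omega_j=1$. The mapping $E:\mathrm{IFS}(X)\to[0,1]$, $E(I)=1-d_{\mathrm{Wu}}(I,I^{\complement})$, is an intuitionistic fuzzy entropy measure (IFEM) on $\mathrm{IFS}(X)$, where $I^{\complement}(x)=\langle\nu_I(x),\mu_I(x)\rangle$ for $x\in X$.
   Context: $\Theta=\{\langle \mu,\nu\rangle\in[0,1]^2 \mid \mu+\nu\le 1\}$. An intuitionistic fuzzy set (IFS) on $X$ is a map $I:X\to\Theta$, $I(x)=\langle\mu_I(x),\nu_I(x)\rangle$; $\mathrm{IFS}(X)$ is the set of all of them. $I$ is a crisp set if $I(x)\in\{\langle1,0\rangle,\langle0,1\rangle\}$ for every $x\in X$. For $I_1,I_2\in\mathrm{IFS}(X)$, $$d_{\mathrm{Wu}}(I_1,I_2)=\sum_{j=1}^n\omega_j\sqrt{\tfrac12\Big(L\big(1-\mu_{I_1}(x_j),1-\mu_{I_2}(x_j)\big)+L\big(\nu_{I_1}(x_j),\nu_{I_2}(x_j)\big)\Big)},\qquad L(p,q)=p\log_2\frac{2p}{p+q}+q\log_2\frac{2q}{p+q}\quad(p,q\ge0),$$ where any term of $L$ whose leading factor is $0$ equals $0$ (including $0\cdot\log_2 0=0\cdot\log_2\frac{0}{0+0}=0$). A map $E:\mathrm{IFS}(X)\to[0,1]$ is an IFEM on $\mathrm{IFS}(X)$ if for all $I_1,I_2\in\mathrm{IFS}(X)$: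 (E1) $E(I_1)=0$ iff $I_1$ is a crisp set; (E2) $E(I_1)=1$ iff $\mu_{I_1}(x)=\nu_{I_1}(x)$ for all $x\in X$; (E3) $E(I_1)=E(I_1^{\complement})$; (E4) $E(I_1)\le E(I_2)$ if for every $x\in X$ either $\mu_{I_1}(x)\le\mu_{I_2}(x)\le\nu_{I_2}(x)\le\nu_{I_1}(x)$ or $\mu_{I_1}(x)\ge\mu_{I_2}(x)\ge\nu_{I_2}(x)\ge\nu_{I_1}(x)$. *)

theory Defs
  imports Complex_Main "HOL-Library.FuncSet"
begin

definition Theta :: "(real \<times> real) set" where
  "Theta = {(\<mu>, \<nu>). \<mu> \<in> {0..1} \<and> \<nu> \<in> {0..1} \<and> \<mu> + \<nu> \<le> 1}"

text \<open>
  The extensional function space makes each intuitionistic fuzzy set on \<open>X\<close> a single HOL function;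
  hence the \<open>restrict\<close> in the complement below.
\<close>

definition IFS :: "'a set \<Rightarrow> ('a \<Rightarrow> real \<times> real) set" where
  "IFS X = X \<rightarrow>\<^sub>E Theta"

definition mu :: "('a \<Rightarrow> real \<times> real) \<Rightarrow> 'a \<Rightarrow> real" where
  "mu I x = fst (I x)"

definition nu :: "('a \<Rightarrow> real \<times> real) \<Rightarrow> 'a \<Rightarrow> real" where
  "nu I x = snd (I x)"

definition crisp :: "'a set \<Rightarrow> ('a \<Rightarrow> real \<times> real) \<Rightarrow> bool" where
  "crisp X I \<longleftrightarrow> (\<forall>x\<in>X. I x \<in> {(1, 0), (0, 1)})"

definition ifs_compl :: "'a set \<Rightarrow> ('a \<Rightarrow> real \<times> real) \<Rightarrow> ('a \<Rightarrow> real \<times> real)" where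
  "ifs_compl X I = (\<lambda>x\<in>X. (nu I x, mu I x))"

text \<open>
  The convention that a term with leading factor \<open>0\<close> is \<open>0\<close> holds automatically, since \<open>log\<close> and
  division are total; for \<open>p > 0\<close> and \<open>q \<ge> 0\<close> the term \<open>p * log 2 (2 * p / (p + q))\<close> is proper.
\<close>

definition L :: "real \<Rightarrow> real \<Rightarrow> real" where
  "L p q = p * log 2 (2 * p / (p + q)) + q * log 2 (2 * q / (p + q))"

definition d_Wu ::
  "nat \<Rightarrow> (nat \<Rightarrow> 'a) \<Rightarrow> (nat \<Rightarrow> real) \<Rightarrow> ('a \<Rightarrow> real \<times> real) \<Rightarrow> ('a \<Rightarrow> real \<times> real) \<Rightarrow> real" where
  "d_Wu n x \<omega> I1 I2 =
    (\<Sum>j = 1..n. \<omega> j * sqrt (1/2 * (L (1 - mu I1 (x j)) (1 - mu I2 (x j))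
                                  + L (nu I1 (x j)) (nu I2 (x j)))))"

definition IFEM :: "'a set \<Rightarrow> (('a \<Rightarrow> real \<times> real) \<Rightarrow> real) \<Rightarrow> bool" where
  "IFEM X E \<longleftrightarrow>
    E \<in> IFS X \<rightarrow> {0..1} \<and>
    (\<forall>I1\<in>IFS X. E I1 = 0 \<longleftrightarrow> crisp X I1) \<and>
    (\<forall>I1\<in>IFS X. E I1 = 1 \<longleftrightarrow> (\<forall>x\<in>X. mu I1 x = nu I1 x)) \<and>
    (\<forall>I1\<in>IFS X. E I1 = E (ifs_compl X I1)) \<and>
    (\<forall>I1\<in>IFS X. \<forall>I2\<in>IFS X.
      (\<forall>x\<in>X. (mu I1 x \<le> mu I2 x \<and> mu I2 x \<le> nu I2 x \<and> nu I2 x \<le> nu I1 x) \<or>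
             (mu I1 x \<ge> mu I2 x \<and> mu I2 x \<ge> nu I2 x \<and> nu I2 x \<ge> nu I1 x))
      \<longrightarrow> E I1 \<le> E I2)"

end

(*
  Write E(I) as the weighted sum of the numbers 1 - sqrt (J/2), where
  J = L (1 - mu) (1 - nu) + L nu mu. All axioms reduce to facts on L for p, q >= 0:
  L p q vanishes only for p = q; L p q <= p + q, with equality only if p or q is 0 (so J <= 2 with
  equality only at crisp points); and L grows when the interval [p, q] grows. The last fact is
  Gibbs' inequality: the normalised pair (p', q') has cross entropy against (p, q) at least its own
  entropy, so L p' q' - L p q is at least
  (p' - p) log (2 p / (p + q)) + (q' - q) log (2 q / (p + q)),
  and both products are nonnegative when p' <= p <= q <= q'.
*)
theory Submission
  imports Defs
begin

text \<open>This is \<open>ln z \<le> z - 1\<close> at \<open>z = y / x\<close>, multiplied by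
  \<open>x\<close>; for \<open>x = 0\<close> the right side is 0.\<close>

lemma mult_ln_div_ge:
  fixes x y :: real
  assumes "0 \<le> x" "0 < y"
  shows "x - y \<le> x * ln (x / y)"
proof (cases "x = 0")
  case False
  with assms have x: "0 < x" by simp
  have "1 - y / x \<le> ln (x / y)"
    using ln_le_minus_one[of "y / x"] x assms by (simp add: ln_div)
  then have "x * (1 - y / x) \<le> x * ln (x / y)"
    using x by (intro mult_left_mono) auto
  then show ?thesis using x by (simp add: algebra_simps)
qed (use assms in simp)

text \<open>The bound \<open>ln z \<le> z - 1\<close> is tight only at \<open>z = 1\<close>. It
  serves to recover \<open>p = q\<close> from \<open>L p q = 0\<close>.\<close>

lemma mult_ln_div_eq_iff:
  fixes x y :: real
  assumes "0 \<le> x" "0 < y"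
  shows "x * ln (x / y) = x - y \<longleftrightarrow> x = y"
proof (cases "x = 0")
  case False
  with assms have x: "0 < x" by simp
  have "x * ln (x / y) = x - y \<longleftrightarrow> ln (y / x) = y / x - 1"
    using x assms by (simp add: ln_div field_simps) argo
  also have "\<dots> \<longleftrightarrow> x = y"
    using ln_eq_minus_one[of "y / x"] x assms by auto
  finally show ?thesis .
qed (use assms in simp)

lemma L_commute: "L p q = L q p"
  by (simp add: L_def add.commute)

lemma L_same [simp]: "L p p = 0"
  by (cases "p = 0") (simp_all add: L_def)

lemma L_zero_left [simp]: "L 0 q = q"
  by (cases "q = 0") (simp_all add: L_def)

lemma L_zero_right [simp]: "L p 0 = p"
  by (subst L_commute) simp

text \<open>In natural logarithms, each term of \<open>L\<close> compares one argument with the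
  midpoint, the form that \<open>mult_ln_div_ge\<close> bounds.\<close>

lemma L_ln: "L p q * ln 2 = p * ln (p / ((p + q) / 2)) + q * ln (q / ((p + q) / 2))"
  by (simp add: L_def log_def field_simps)

text \<open>Gibbs' inequality scaled by the mass \<open>p' + q'\<close>. The reference pair must be
  positive: at \<open>p = 0\<close> the default value of \<open>log 2 0\<close> would replace an
  infinite cross entropy.\<close>

lemma L_cross_entropy_le:
  assumes "0 \<le> p'" "0 \<le> q'" "0 < p" "0 < q"
  shows "p' * log 2 (2 * p / (p + q)) + q' * log 2 (2 * q / (p + q)) \<le> L p' q'"
proof (cases "p' + q' = 0")
  case True
  with assms have "p' = 0" "q' = 0" by auto
  then show ?thesis by simp
next
  case False
  define s where "s = p' + q'"
  have s: "0 < s" using False assms by (simp add: s_def)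
  \<comment> \<open>The reference entry \<open>b\<close> is rescaled to
    \<open>s * b / (p + q)\<close>, so that both pairs have mass \<open>s\<close>. The case
    \<open>a = 0\<close> is separate because the logarithm of the quotient is split below.\<close>
  have gibbs: "a * ln (2 * b / (p + q)) + (a - s * b / (p + q)) \<le> a * ln (a / (s / 2))"
    if "0 \<le> a" "0 < b" for a b
  proof (cases "a = 0")
    case True
    then show ?thesis using that s assms by simp
  next
    case False
    have "a - s * b / (p + q) \<le> a * ln (a / (s * b / (p + q)))"
      using that s assms by (intro mult_ln_div_ge) auto
    also have "ln (a / (s * b / (p + q))) = ln (a / (s / 2)) - ln (2 * b / (p + q))"
      using that False s assms by (simp add: ln_div ln_mult)
    finally show ?thesis by (simp add: algebra_simps)
  qed
  \<comment> \<open>Equal masses make the linear remainders of the two instances of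
    \<open>gibbs\<close> cancel.\<close>
  have "s * p / (p + q) + s * q / (p + q) = s"
    using assms by (simp flip: add_divide_distrib distrib_left)
  with gibbs[of p' p] gibbs[of q' q] assms
  have "p' * ln (2 * p / (p + q)) + q' * ln (2 * q / (p + q)) \<le> L p' q' * ln 2"
    unfolding L_ln s_def[symmetric] by (simp add: s_def)
  then show ?thesis
    by (simp add: log_def field_simps)
qed

lemma L_mono_interval:
  assumes "0 \<le> p'" "p' \<le> p" "p \<le> q" "q \<le> q'"
  shows "L p q \<le> L p' q'"
proof (cases "p = 0")
  case True
  with assms show ?thesis by simp
next
  case False
  with assms have pos: "0 < p" "0 < q" by auto
  have "L p q \<le> p' * log 2 (2 * p / (p + q)) + q' * log 2 (2 * q / (p + q))"
  proof -
    \<comment> \<open>The midpoint lies between \<open>p\<close> and \<open>q\<close>, which fixes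
      both signs; lowering the first weight and raising the second can then only increase the
      sum.\<close>
    have "log 2 (2 * p / (p + q)) \<le> 0" "0 \<le> log 2 (2 * q / (p + q))"
      using pos assms by auto
    then have "p * log 2 (2 * p / (p + q)) \<le> p' * log 2 (2 * p / (p + q))"
      "q * log 2 (2 * q / (p + q)) \<le> q' * log 2 (2 * q / (p + q))"
      using assms by (auto intro: mult_right_mono mult_right_mono_neg)
    then show ?thesis by (simp add: L_def)
  qed
  also have "\<dots> \<le> L p' q'"
    using assms pos by (intro L_cross_entropy_le) auto
  finally show ?thesis .
qed

text \<open>The interval between \<open>p\<close> and \<open>q\<close> contains a degenerate one, on
  which \<open>L\<close> is 0.\<close>

lemma L_nonneg:
  assumes "0 \<le> p" "0 \<le> q"
  shows "0 \<le> L p q"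
  using L_mono_interval[of p p p q] L_mono_interval[of q q q p] assms
  by (cases "p \<le> q") (auto simp: L_commute)

lemma L_eq_0_iff:
  assumes "0 \<le> p" "0 \<le> q"
  shows "L p q = 0 \<longleftrightarrow> p = q"
proof
  assume L0: "L p q = 0"
  show "p = q"
  proof (cases "p + q = 0")
    case False
    define y where "y = (p + q) / 2"
    have y: "0 < y" using False assms by (simp add: y_def)
    have "p * ln (p / y) + q * ln (q / y) = 0"
      using L_ln[of p q] L0 by (simp add: y_def)
    \<comment> \<open>The two lower bounds add up to 0, as does the sum they bound, so each of them
      is attained.\<close>
    moreover have "p - y \<le> p * ln (p / y)" "q - y \<le> q * ln (q / y)"
      using assms y by (auto intro: mult_ln_div_ge)
    moreover have "p - y + (q - y) = 0" by (simp add: y_def)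
    ultimately have "p * ln (p / y) = p - y" by linarith
    then have "p = y" using mult_ln_div_eq_iff assms y by blast
    then show ?thesis by (simp add: y_def)
  qed (use assms in auto)
qed simp

text \<open>The ratio \<open>2 * p / (p + q)\<close> is at most 2 for \<open>p > 0\<close>, and
  below 2 once \<open>q > 0\<close>.\<close>

lemma mult_log2_ratio_le:
  assumes "0 \<le> p" "0 \<le> q"
  shows "p * log 2 (2 * p / (p + q)) \<le> p"
    and "0 < p \<Longrightarrow> 0 < q \<Longrightarrow> p * log 2 (2 * p / (p + q)) < p"
proof -
  show strict: "p * log 2 (2 * p / (p + q)) < p" if "0 < p" "0 < q"
  proof -
    have "log 2 (2 * p / (p + q)) < 1"
      using that by (simp add: log_less_one_cancel_iff field_simps)
    then show ?thesis using that by simp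
  qed
  show "p * log 2 (2 * p / (p + q)) \<le> p"
    using strict assms by (cases "p = 0"; cases "q = 0") (auto intro: less_imp_le)
qed

lemma L_le_add:
  assumes "0 \<le> p" "0 \<le> q"
  shows "L p q \<le> p + q"
  using mult_log2_ratio_le(1)[of p q] mult_log2_ratio_le(1)[of q p] assms
  by (simp add: L_def add.commute)

lemma L_less_add:
  assumes "0 < p" "0 < q"
  shows "L p q < p + q"
  using mult_log2_ratio_le(2)[of p q] mult_log2_ratio_le(2)[of q p] assms
  unfolding L_def add.commute[of q p] by linarith

text \<open>Twice the radicand of \<open>d_Wu\<close> at a point with values \<open>m\<close>,
  \<open>v\<close>, when the second set is the complement of the first.\<close>

definition J :: "real \<Rightarrow> real \<Rightarrow> real" where
  "J m v = L (1 - m) (1 - v) + L v m"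

lemma J_commute: "J m v = J v m"
  by (simp add: J_def L_commute)

lemma J_nonneg: "(m, v) \<in> Theta \<Longrightarrow> 0 \<le> J m v"
  by (auto simp: J_def Theta_def intro!: add_nonneg_nonneg L_nonneg)

lemma J_eq_0_iff: "(m, v) \<in> Theta \<Longrightarrow> J m v = 0 \<longleftrightarrow> m = v"
  using L_nonneg[of "1 - m" "1 - v"] L_nonneg[of v m] L_eq_0_iff[of v m]
  by (auto simp: J_def Theta_def add_nonneg_eq_0_iff)

text \<open>The bounds \<open>2 - m - v\<close> and \<open>v + m\<close> on the two summands add up
  to exactly 2.\<close>

lemma J_le_2: "(m, v) \<in> Theta \<Longrightarrow> J m v \<le> 2"
  using L_le_add[of "1 - m" "1 - v"] L_le_add[of v m] by (auto simp: J_def Theta_def)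

lemma J_eq_2_iff:
  assumes "(m, v) \<in> Theta"
  shows "J m v = 2 \<longleftrightarrow> (m, v) \<in> {(1, 0), (0, 1)}"
proof
  assume J2: "J m v = 2"
  have mv: "0 \<le> m" "0 \<le> v" "m \<le> 1" "v \<le> 1" "m + v \<le> 1"
    using assms by (auto simp: Theta_def)
  \<comment> \<open>A total of 2 forces both bounds to be tight, and by \<open>L_less_add\<close>
    each then needs a zero argument.\<close>
  have "L (1 - m) (1 - v) = 1 - m + (1 - v)" "L v m = v + m"
    using L_le_add[of "1 - m" "1 - v"] L_le_add[of v m] mv J2 by (auto simp: J_def)
  then have "m = 1 \<or> v = 1" "v = 0 \<or> m = 0"
    using L_less_add[of "1 - m" "1 - v"] L_less_add[of v m] mv by force+
  then show "(m, v) \<in> {(1, 0), (0, 1)}" by auto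
qed (auto simp: J_def)

text \<open>The reflection \<open>z \<mapsto> 1 - z\<close> preserves nesting of intervals, so both
  summands grow by \<open>L_mono_interval\<close>.\<close>

lemma J_mono:
  assumes "(m1, v1) \<in> Theta" "m1 \<le> m2" "m2 \<le> v2" "v2 \<le> v1"
  shows "J m2 v2 \<le> J m1 v1"
  using L_mono_interval[of "1 - v1" "1 - v2" "1 - m2" "1 - m1"] L_mono_interval[of m1 m2 v2 v1] assms
  by (auto simp: J_def L_commute Theta_def)

lemma weighted_sum_eq_0_iff:
  fixes w f :: "'b \<Rightarrow> real"
  assumes "finite A" "\<And>j. j \<in> A \<Longrightarrow> 0 < w j" "\<And>j. j \<in> A \<Longrightarrow> 0 \<le> f j"
  shows "(\<Sum>j\<in>A. w j * f j) = 0 \<longleftrightarrow> (\<forall>j\<in>A. f j = 0)"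
proof -
  have "(\<Sum>j\<in>A. w j * f j) = 0 \<longleftrightarrow> (\<forall>j\<in>A. w j * f j = 0)"
    using assms by (intro sum_nonneg_eq_0_iff) (auto intro: mult_nonneg_nonneg less_imp_le)
  then show ?thesis using assms(2) by fastforce
qed

theorem theorem4:
  fixes X :: "'a set" and n :: nat and x :: "nat \<Rightarrow> 'a" and \<omega> :: "nat \<Rightarrow> real"
  assumes "finite X"
    and "bij_betw x {1..n} X"
    and "\<And>j. j \<in> {1..n} \<Longrightarrow> \<omega> j \<in> {0<..1}"
    and "(\<Sum>j = 1..n. \<omega> j) = 1"
  shows "IFEM X (\<lambda>I. 1 - d_Wu n x \<omega> I (ifs_compl X I))"
proof -
  define d where "d I = d_Wu n x \<omega> I (ifs_compl X I)" for I
  define t where "t I y = sqrt (J (mu I y) (nu I y) / 2)" for I :: "'a \<Rightarrow> real \<times> real" and y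
  have X_eq: "X = x ` {1..n}"
    using assms(2) by (simp add: bij_betw_def)
  have x_in: "x j \<in> X" if "j \<in> {1..n}" for j
    using that X_eq by blast
  have w_pos: "0 < \<omega> j" if "j \<in> {1..n}" for j
    using assms(3)[OF that] by simp
  have compl: "mu (ifs_compl X I) y = nu I y" "nu (ifs_compl X I) y = mu I y" if "y \<in> X" for I y
    using that by (simp_all add: ifs_compl_def mu_def nu_def)
  have d_eq: "d I = (\<Sum>j = 1..n. \<omega> j * t I (x j))" for I
    unfolding d_def d_Wu_def t_def J_def
    by (intro sum.cong refl) (simp add: compl x_in)
  \<comment> \<open>Since the weights sum to 1, \<open>1 - d I\<close> is again a weighted sum of
    nonnegative terms; \<open>weighted_sum_eq_0_iff\<close> thus also settles when it
    vanishes.\<close>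
  have d_compl: "1 - d I = (\<Sum>j = 1..n. \<omega> j * (1 - t I (x j)))" for I
    unfolding d_eq by (simp add: right_diff_distrib sum_subtractf assms(4)[simplified])
  have Theta: "(mu I y, nu I y) \<in> Theta" if "I \<in> IFS X" "y \<in> X" for I y
    using that by (auto simp: IFS_def mu_def nu_def)
  have t_bounds: "0 \<le> t I y" "t I y \<le> 1" if "I \<in> IFS X" "y \<in> X" for I y
    using J_nonneg[OF Theta[OF that]] J_le_2[OF Theta[OF that]] by (auto simp: t_def)
  have t_mono: "t I2 y \<le> t I1 y"
    if "I1 \<in> IFS X" "y \<in> X"
      and "(mu I1 y \<le> mu I2 y \<and> mu I2 y \<le> nu I2 y \<and> nu I2 y \<le> nu I1 y) \<or>
           (mu I1 y \<ge> mu I2 y \<and> mu I2 y \<ge> nu I2 y \<and> nu I2 y \<ge> nu I1 y)" for I1 I2 y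
  proof -
    \<comment> \<open>The second alternative of (E4) is the first with \<open>mu\<close> and
      \<open>nu\<close> exchanged, and \<open>J\<close> is symmetric.\<close>
    have swap: "(nu I1 y, mu I1 y) \<in> Theta"
      using Theta[OF that(1,2)] by (auto simp: Theta_def)
    show ?thesis
      using J_mono[OF Theta[OF that(1,2)], of "mu I2 y" "nu I2 y"]
        J_mono[OF swap, of "nu I2 y" "mu I2 y"] that(3)
      by (auto simp: t_def J_commute[of "nu I1 y"] J_commute[of "nu I2 y"])
  qed
  have "1 - d I \<in> {0..1}" if I: "I \<in> IFS X" for I
  proof -
    have "0 \<le> d I"
      unfolding d_eq using I
      by (intro sum_nonneg mult_nonneg_nonneg less_imp_le[OF w_pos] t_bounds x_in) auto
    moreover have "0 \<le> 1 - d I"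
      unfolding d_compl using I t_bounds(2) x_in w_pos
      by (intro sum_nonneg mult_nonneg_nonneg) (auto intro: less_imp_le)
    ultimately show ?thesis by simp
  qed
  moreover have "1 - d I = 0 \<longleftrightarrow> crisp X I" if I: "I \<in> IFS X" for I
  proof -
    have "1 - d I = 0 \<longleftrightarrow> (\<forall>j\<in>{1..n}. 1 - t I (x j) = 0)"
      unfolding d_compl using I t_bounds(2) x_in w_pos
      by (intro weighted_sum_eq_0_iff) auto
    also have "\<dots> \<longleftrightarrow> (\<forall>y\<in>X. J (mu I y) (nu I y) = 2)"
      unfolding X_eq by (auto simp: t_def)
    also have "\<dots> \<longleftrightarrow> crisp X I"
      unfolding crisp_def using J_eq_2_iff[OF Theta[OF I]] by (simp add: mu_def nu_def)
    finally show ?thesis .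
  qed
  moreover have "1 - d I = 1 \<longleftrightarrow> (\<forall>y\<in>X. mu I y = nu I y)" if I: "I \<in> IFS X" for I
  proof -
    have "1 - d I = 1 \<longleftrightarrow> (\<forall>j\<in>{1..n}. t I (x j) = 0)"
      using weighted_sum_eq_0_iff[of "{1..n}" \<omega> "\<lambda>j. t I (x j)"] I t_bounds(1) x_in w_pos
      by (simp add: d_eq)
    also have "\<dots> \<longleftrightarrow> (\<forall>y\<in>X. J (mu I y) (nu I y) = 0)"
      unfolding X_eq by (auto simp: t_def)
    also have "\<dots> \<longleftrightarrow> (\<forall>y\<in>X. mu I y = nu I y)"
      using J_eq_0_iff[OF Theta[OF I]] by simp
    finally show ?thesis .
  qed
  moreover have "d I = d (ifs_compl X I)" for I
    unfolding d_eq t_def by (intro sum.cong refl) (simp add: compl x_in J_commute)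
  moreover have "1 - d I1 \<le> 1 - d I2"
    if "I1 \<in> IFS X" and "\<forall>y\<in>X. (mu I1 y \<le> mu I2 y \<and> mu I2 y \<le> nu I2 y \<and> nu I2 y \<le> nu I1 y) \<or>
           (mu I1 y \<ge> mu I2 y \<and> mu I2 y \<ge> nu I2 y \<and> nu I2 y \<ge> nu I1 y)" for I1 I2
  proof -
    have "d I2 \<le> d I1"
      unfolding d_eq using that x_in
      by (intro sum_mono mult_left_mono less_imp_le[OF w_pos] t_mono) auto
    then show ?thesis by simp
  qed
  ultimately show ?thesis
    unfolding IFEM_def d_def[symmetric] by (intro conjI ballI impI Pi_I) auto
qed

end
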